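(* Let $k$ be a field, $n\ge 2$, and $T=k[x_{ij},y_i\mid 1\le i,j\le n]$. Let $X=(x_{rs})_{n\times n}$ and $Y=(y_1,\ldots,y_n)^t$ be generic matrices of indeterminates, let $f_r=\sum_{s=1}^n x_{rs}y_s$ for $1\le r\le n$, and let $\mathcal{I}=I_1(XY)=\langle f_1,\ldots,f_n\rangle$. Let $1\le p,q,i\le n$ with $p\ne i$ and $p\neq q$, and let $$H=\begin{pmatrix} x_{i1}&x_{i2}&\cdots&x_{i(i-1)}&x_{i(i+1)}&\cdots&x_{i(n-1)}&x_{in}\\ x_{i2}&x_{i3}&\cdots&x_{i(i+1)}&x_{i(i+2)}&\cdots&x_{in}&x_{pq}\end{pmatrix}.$$ Let $\mathcal{J}=I_2(H)$ be the ideal generated by the $2\times2$ minors of $H$. Then $\mathcal{I}\cap\mathcal{J}=\mathcal{I}\mathcal{J}$.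
   Context: The matrix $H$ is the $2\times (n-1)$ matrix $\begin{pmatrix} z_1&\cdots&z_{n-1}\\ z_2&\cdots&z_n\end{pmatrix}$, where $z_1,\ldots,z_{n-1}$ is the list $x_{i1},x_{i2},\ldots,x_{in}$ with $x_{ii}$ omitted (in increasing order of the second index) and $z_n=x_{pq}$. *)

theory Defs
  imports
    "HOL-Library.Poly_Mapping"
    "HOL-Algebra.Ideal_Product"
    "Jordan_Normal_Form.Determinant"
    "Jordan_Normal_Form.DL_Submatrix"
begin

section \<open>Polynomial rings in a set of indeterminates\<close>

text \<open>A polynomial is a finitely supported map from monomials (finitely supported exponent
  functions) to coefficients; ring operations are those of \<^theory>\<open>HOL-Library.Poly_Mapping\<close>.\<close>

type_synonym ('v, 'k) mpoly = "('v \<Rightarrow>\<^sub>0 nat) \<Rightarrow>\<^sub>0 'k"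

definition indet :: "'v \<Rightarrow> ('v, 'k::comm_ring_1) mpoly" where
  "indet v = Poly_Mapping.single (Poly_Mapping.single v 1) 1"

definition mpoly_ring :: "'v set \<Rightarrow> ('v, 'k::comm_ring_1) mpoly ring" where
  "mpoly_ring V =
     \<lparr>carrier = {f. \<forall>m \<in> Poly_Mapping.keys f. Poly_Mapping.keys m \<subseteq> V},
      monoid.mult = (*), one = 1, zero = 0, add = (+)\<rparr>"

section \<open>Determinantal ideals\<close>

definition minors :: "nat \<Rightarrow> 'a::comm_ring_1 mat \<Rightarrow> 'a set" where
  "minors t M = {det (submatrix M R C) | R C.
     R \<subseteq> {..<dim_row M} \<and> C \<subseteq> {..<dim_col M} \<and> card R = t \<and> card C = t}"

definition det_ideal :: "('a::comm_ring_1, 'b) ring_scheme \<Rightarrow> nat \<Rightarrow> 'a mat \<Rightarrow> 'a set" where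
  "det_ideal T t M = Idl\<^bsub>T\<^esub> (minors t M)"

section \<open>The generic matrices\<close>

text \<open>The indeterminates carry the usual indices from 1 to n, whereas rows and columns of
  \<^typ>\<open>'a mat\<close> are numbered from 0.\<close>

datatype gvar = XVar nat nat | YVar nat

definition gvars :: "nat \<Rightarrow> gvar set" where
  "gvars n = {XVar i j | i j. i \<in> {1..n} \<and> j \<in> {1..n}} \<union> {YVar i | i. i \<in> {1..n}}"

abbreviation xx :: "nat \<Rightarrow> nat \<Rightarrow> (gvar, 'k::comm_ring_1) mpoly" where
  "xx r s \<equiv> indet (XVar r s)"

abbreviation yy :: "nat \<Rightarrow> (gvar, 'k::comm_ring_1) mpoly" where
  "yy r \<equiv> indet (YVar r)"

definition X_mat :: "nat \<Rightarrow> (gvar, 'k::comm_ring_1) mpoly mat" where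
  "X_mat n = mat n n (\<lambda>(r, s). xx (r + 1) (s + 1))"

definition Y_mat :: "nat \<Rightarrow> (gvar, 'k::comm_ring_1) mpoly mat" where
  "Y_mat n = mat n 1 (\<lambda>(r, _). yy (r + 1))"

text \<open>The list \<open>z\<^sub>1, \<dots>, z\<^sub>n\<close>: row i of the generic matrix with its diagonal entry omitted,
  followed by the entry in position (p, q). The rows of \<open>H_mat\<close> are
  \<open>z\<^sub>1, \<dots>, z\<^sub>n\<^sub>-\<^sub>1\<close> and \<open>z\<^sub>2, \<dots>, z\<^sub>n\<close>.\<close>

definition H_entries :: "nat \<Rightarrow> nat \<Rightarrow> nat \<Rightarrow> nat \<Rightarrow> (gvar, 'k::comm_ring_1) mpoly list" where
  "H_entries n p q i = map (xx i) (filter (\<lambda>j. j \<noteq> i) [1..<n + 1]) @ [xx p q]"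

definition H_mat :: "nat \<Rightarrow> nat \<Rightarrow> nat \<Rightarrow> nat \<Rightarrow> (gvar, 'k::comm_ring_1) mpoly mat" where
  "H_mat n p q i = mat 2 (n - 1) (\<lambda>(r, c). H_entries n p q i ! (c + r))"

section \<open>Basic facts\<close>

lemma mpoly_ring_simps [simp]:
  "monoid.mult (mpoly_ring V) = (*)" "one (mpoly_ring V) = 1"
  "zero (mpoly_ring V) = 0" "add (mpoly_ring V) = (+)"
  by (simp_all add: mpoly_ring_def)

lemma mem_mpoly_ring:
  "f \<in> carrier (mpoly_ring V) \<longleftrightarrow> (\<forall>m \<in> Poly_Mapping.keys f. Poly_Mapping.keys m \<subseteq> V)"
  by (simp add: mpoly_ring_def)

lemma indet_in_mpoly_ring [simp]:
  "(indet v :: ('v, 'k::comm_ring_1) mpoly) \<in> carrier (mpoly_ring V) \<longleftrightarrow> v \<in> V"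
  by (simp add: mem_mpoly_ring indet_def)

lemma mpoly_ring_add_closed:
  assumes "f \<in> carrier (mpoly_ring V)" "g \<in> carrier (mpoly_ring V)"
  shows "f + g \<in> carrier (mpoly_ring V)"
  using assms Poly_Mapping.keys_add[of f g] unfolding mem_mpoly_ring by blast

lemma mpoly_ring_mult_closed:
  assumes "f \<in> carrier (mpoly_ring V)" "g \<in> carrier (mpoly_ring V)"
  shows "f * g \<in> carrier (mpoly_ring V)"
  unfolding mem_mpoly_ring
proof
  fix m assume "m \<in> Poly_Mapping.keys (f * g)"
  then obtain a b where ab: "a \<in> Poly_Mapping.keys f" "b \<in> Poly_Mapping.keys g" "m = a + b"
    using Poly_Mapping.keys_mult[of f g] by blast
  then show "Poly_Mapping.keys m \<subseteq> V"
    using assms Poly_Mapping.keys_add[of a b] unfolding mem_mpoly_ring by blast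
qed

lemma mpoly_ring_uminus_closed:
  assumes "f \<in> carrier (mpoly_ring V)"
  shows "- f \<in> carrier (mpoly_ring V)"
  using assms unfolding mem_mpoly_ring by simp

lemma cring_mpoly_ring: "cring (mpoly_ring V :: ('v, 'k::comm_ring_1) mpoly ring)"
proof (rule cringI)
  show "abelian_group (mpoly_ring V :: ('v, 'k) mpoly ring)"
  proof (rule abelian_groupI)
    fix f :: "('v, 'k) mpoly" assume f: "f \<in> carrier (mpoly_ring V)"
    show "\<exists>g \<in> carrier (mpoly_ring V). g \<oplus>\<^bsub>mpoly_ring V\<^esub> f = \<zero>\<^bsub>mpoly_ring V\<^esub>"
      using mpoly_ring_uminus_closed[OF f] by (intro bexI[of _ "- f"]) auto
  qed (simp_all add: mpoly_ring_add_closed ac_simps mem_mpoly_ring[of 0])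
  show "Group.comm_monoid (mpoly_ring V :: ('v, 'k) mpoly ring)"
    by (rule comm_monoidI)
      (simp_all add: mpoly_ring_mult_closed ac_simps mem_mpoly_ring[of 1])
qed (simp add: distrib_right)

lemma minors_1: "minors 1 M = {M $$ (r, c) | r c. r < dim_row M \<and> c < dim_col M}"
proof -
  have eq: "det (submatrix M {r} {c}) = M $$ (r, c)"
    if "r < dim_row M" "c < dim_col M" for r c
  proof -
    have c1: "{i. i < dim_row M \<and> i \<in> {r}} = {r}" "{i. i < dim_col M \<and> i \<in> {c}} = {c}"
      using that by auto
    have "submatrix M {r} {c} \<in> carrier_mat 1 1"
      by (rule carrier_matI; unfold dim_submatrix c1; simp)
    then have "det (submatrix M {r} {c}) = submatrix M {r} {c} $$ (0, 0)"
      by (rule det_single)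
    also have "\<dots> = M $$ (pick {r} 0, pick {c} 0)"
      by (rule submatrix_index; unfold c1; simp)
    also have "\<dots> = M $$ (r, c)" by (simp add: Least_equality)
    finally show ?thesis .
  qed
  show ?thesis
  proof (intro equalityI subsetI)
    fix a assume "a \<in> minors 1 M"
    then obtain R C where "R \<subseteq> {..<dim_row M}" "C \<subseteq> {..<dim_col M}" "card R = 1" "card C = 1"
      "a = det (submatrix M R C)" unfolding minors_def by auto
    then show "a \<in> {M $$ (r, c) | r c. r < dim_row M \<and> c < dim_col M}"
      using eq by (auto simp: card_1_singleton_iff)
  next
    fix a assume "a \<in> {M $$ (r, c) | r c. r < dim_row M \<and> c < dim_col M}"
    then obtain r c where rc: "r < dim_row M" "c < dim_col M" "a = M $$ (r, c)" by auto
    then show "a \<in> minors 1 M"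
      unfolding minors_def mem_Collect_eq using eq[OF rc(1,2)]
      by (intro exI[of _ "{r}"] exI[of _ "{c}"]) simp
  qed
qed

lemma minors_1_XY:
  "minors 1 (X_mat n * Y_mat n) = {\<Sum>s = 1..n. xx r s * yy s | r. r \<in> {1..n}}" (is "?L = ?R")
proof -
  have *: "(X_mat n * Y_mat n) $$ (r, 0) = (\<Sum>s = 1..n. xx (Suc r) s * yy s)" if "r < n" for r
  proof -
    have "(X_mat n * Y_mat n) $$ (r, 0) = (\<Sum>s = 0..<n. xx (Suc r) (Suc s) * yy (Suc s))"
      using that by (simp add: X_mat_def Y_mat_def scalar_prod_def)
    also have "\<dots> = (\<Sum>s = 1..n. xx (Suc r) s * yy s)"
      by (rule sum.reindex_bij_witness[of _ "\<lambda>s. s - 1" Suc]) auto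
    finally show ?thesis .
  qed
  have d: "dim_row (X_mat n * Y_mat n) = n" "dim_col (X_mat n * Y_mat n) = 1"
    by (simp_all add: X_mat_def Y_mat_def)
  have "?L = (\<lambda>r. \<Sum>s = 1..n. xx (Suc r) s * yy s) ` {..<n}"
    unfolding minors_1 d using * by force
  also have "\<dots> = (\<lambda>r. \<Sum>s = 1..n. xx r s * yy s) ` Suc ` {..<n}"
    by (simp add: image_image)
  also have "Suc ` {..<n} = {1..n}"
    by (simp add: image_Suc_lessThan)
  also have "(\<lambda>r. \<Sum>s = 1..n. xx r s * yy s) ` {1..n} = ?R" by auto
  finally show ?thesis .
qed

lemma det_ideal_XY:
  "det_ideal T 1 (X_mat n * Y_mat n) =
     Idl\<^bsub>T\<^esub> {\<Sum>s = 1..n. xx r s * yy s | r. r \<in> {1..n}}"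
  unfolding det_ideal_def minors_1_XY by (rule refl)

lemma length_H_entries:
  assumes "i \<in> {1..n}"
  shows "length (H_entries n p q i) = n"
proof -
  have "length (filter (\<lambda>j. j \<noteq> i) [1..<n + 1]) = card ({1..<n + 1} - {i})"
    by (subst distinct_card[symmetric]) (auto intro: arg_cong[of _ _ card])
  also have "\<dots> = n - 1" using assms by simp
  finally show ?thesis using assms by (simp add: H_entries_def)
qed

end

theory Submission
  imports Defs
begin

text \<open>Write \<open>f\<^sub>r = x\<^sub>r\<^sub>r y\<^sub>r + g\<^sub>r\<close>. The monomials \<open>u\<^sub>r = x\<^sub>r\<^sub>r y\<^sub>r\<close> are pairwise
  coprime, and every monomial of \<open>g\<^sub>r\<close> is free of diagonal indeterminates. So, with monomials
  weighted by their degree in \<open>x\<^sub>1\<^sub>1, \<dots>, x\<^sub>n\<^sub>n\<close>, the \<open>u\<^sub>r\<close> act as leading terms. As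
  \<open>x\<^sub>i\<^sub>i\<close> is left out of row \<open>i\<close> and \<open>p \<noteq> q\<close>, no entry of \<open>H\<close> is a diagonal indeterminate or
  one of the \<open>y\<^sub>r\<close>. Hence \<open>J\<close> is generated by polynomials in indeterminates that divide none
  of the \<open>u\<^sub>r\<close>.

  Rewriting \<open>u\<^sub>r\<close> to \<open>- g\<^sub>r\<close> lowers the weight, so it ends in a normal form, and coprimality
  makes the result independent of the order of the steps (\<open>nf_confluent\<close>). Extended linearly,
  the normal form map \<open>NF\<close> has three properties: it vanishes on \<open>I\<close> (\<open>NF_ideal_eq_0\<close>), it
  moves every polynomial by an element of \<open>I\<close> only (\<open>diff_NF_in_ideal\<close>), and it is linear over
  the polynomials in indeterminates outside all \<open>u\<^sub>r\<close> (\<open>NF_mult_coprime\<close>).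

  Now let \<open>x = \<Sum> c\<^sub>k m\<^sub>k\<close> lie in \<open>I \<inter> J\<close>, with \<open>m\<^sub>k\<close> generators of \<open>J\<close>. Then
  \<open>0 = NF x = \<Sum> NF c\<^sub>k m\<^sub>k\<close>, so \<open>x = \<Sum> (c\<^sub>k - NF c\<^sub>k) m\<^sub>k\<close>, which is in \<open>I J\<close>. In other
  words, subtracting the normal form is a retraction of the whole ring onto \<open>I\<close> that is linear
  over a subring containing the generators of \<open>J\<close>.\<close>

section \<open>Linear extension from monomials\<close>

lemma mpoly_add_induct [case_names zero single add]:
  assumes "P 0"
    and single: "\<And>m c. P (Poly_Mapping.single m c)"
    and add: "\<And>p q. P p \<Longrightarrow> P q \<Longrightarrow> P (p + q)"
  shows "P (p :: 'a \<Rightarrow>\<^sub>0 'k::comm_monoid_add)"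
proof (induction p rule: update_induct)
  case (update p a b)
  have "Poly_Mapping.update a b p = Poly_Mapping.single a b + p"
    using update(1)
    by (intro poly_mapping_eqI) (auto simp: lookup_update lookup_add lookup_single in_keys_iff when_def)
  with add[OF single update(3)] show ?case by simp
qed fact

definition lin_ext :: "('a \<Rightarrow> ('v, 'k::comm_ring_1) mpoly) \<Rightarrow> ('a \<Rightarrow>\<^sub>0 'k) \<Rightarrow> ('v, 'k) mpoly" where
  "lin_ext F p = (\<Sum>m\<in>Poly_Mapping.keys p. Poly_Mapping.single 0 (Poly_Mapping.lookup p m) * F m)"

lemma lin_ext_superset:
  assumes "finite A" "Poly_Mapping.keys p \<subseteq> A"
  shows "lin_ext F p = (\<Sum>m\<in>A. Poly_Mapping.single 0 (Poly_Mapping.lookup p m) * F m)"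
  unfolding lin_ext_def using assms
  by (intro sum.mono_neutral_left) (auto simp: in_keys_iff)

lemma lin_ext_single [simp]: "lin_ext F (Poly_Mapping.single m c) = Poly_Mapping.single 0 c * F m"
  by (subst lin_ext_superset[of "{m}"]) auto

lemma lin_ext_0 [simp]: "lin_ext F 0 = 0"
  by (simp add: lin_ext_def)

lemma lin_ext_add: "lin_ext F (p + q) = lin_ext F p + lin_ext F q"
proof -
  let ?A = "Poly_Mapping.keys p \<union> Poly_Mapping.keys q"
  have "lin_ext F (p + q)
      = (\<Sum>m\<in>?A. Poly_Mapping.single 0 (Poly_Mapping.lookup (p + q) m) * F m)"
    by (intro lin_ext_superset) (auto simp: Poly_Mapping.keys_add)
  then show ?thesis
    by (simp add: lin_ext_superset[of ?A] lookup_add single_add distrib_right sum.distrib)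
qed

lemma lin_ext_cong:
  assumes "\<And>m. m \<in> Poly_Mapping.keys p \<Longrightarrow> F m = G m"
  shows "lin_ext F p = lin_ext G p"
  unfolding lin_ext_def using assms by (intro sum.cong) auto

lemma lin_ext_uminus_fun: "lin_ext (\<lambda>m. - F m) p = - lin_ext F p"
  by (simp add: lin_ext_def sum_negf)

lemma lin_ext_mult_fun: "lin_ext (\<lambda>m. a * F m) p = a * lin_ext F p"
  by (simp add: lin_ext_def sum_distrib_left ac_simps)

lemma lin_ext_single_mult:
  fixes F :: "'a::comm_monoid_add \<Rightarrow> ('v, 'k::comm_ring_1) mpoly"
  shows "lin_ext F (Poly_Mapping.single t c * p)
    = Poly_Mapping.single 0 c * lin_ext (\<lambda>m. F (t + m)) p"
proof (induction p rule: mpoly_add_induct)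
  case (single m d)
  have "Poly_Mapping.single 0 (c * d)
      = Poly_Mapping.single 0 c * (Poly_Mapping.single 0 d :: ('v, 'k) mpoly)"
    by (simp add: mult_single)
  then show ?case by (simp add: mult_single flip: mult.assoc)
qed (simp_all add: distrib_left lin_ext_add)

lemma lin_ext_mult:
  fixes F :: "'a::comm_monoid_add \<Rightarrow> ('v, 'k::comm_ring_1) mpoly"
  shows "lin_ext F (p * q) = lin_ext (\<lambda>a. lin_ext (\<lambda>b. F (a + b)) q) p"
  by (induction p rule: mpoly_add_induct)
    (simp_all add: lin_ext_single_mult distrib_right lin_ext_add)

lemma lin_ext_diff_fun: "lin_ext (\<lambda>m. F m - G m) p = lin_ext F p - lin_ext G p"
  by (simp add: lin_ext_def right_diff_distrib sum_subtractf)

lemma lin_ext_monomial: "lin_ext (\<lambda>m. Poly_Mapping.single m 1) p = p"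
  by (induction p rule: mpoly_add_induct) (simp_all add: lin_ext_add mult_single)

section \<open>Ideals of polynomial rings\<close>

lemma mpoly_idealI:
  fixes K :: "('v, 'k::comm_ring_1) mpoly set"
  assumes "K \<subseteq> carrier (mpoly_ring V)" "0 \<in> K" "\<And>x y. x \<in> K \<Longrightarrow> y \<in> K \<Longrightarrow> x + y \<in> K"
    and mult: "\<And>a x. a \<in> carrier (mpoly_ring V) \<Longrightarrow> x \<in> K \<Longrightarrow> a * x \<in> K"
  shows "ideal K (mpoly_ring V)"
proof -
  interpret T: cring "mpoly_ring V :: ('v, 'k) mpoly ring" by (rule cring_mpoly_ring)
  have neg: "- x \<in> K" if "x \<in> K" for x
    using mult[of "- 1" x] that by (simp add: mem_mpoly_ring)
  have inv: "\<ominus>\<^bsub>mpoly_ring V\<^esub> x = - x" if "x \<in> K" for x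
    using that neg[OF that] assms(1) by (intro T.minus_equality) auto
  have mult': "x * a \<in> K" if "a \<in> carrier (mpoly_ring V)" "x \<in> K" for a x
    using mult[OF that] by (simp add: mult.commute)
  show ?thesis
  proof (rule idealI)
    show "subgroup K (add_monoid (mpoly_ring V))"
      using assms neg inv by (intro T.add.subgroupI) (auto simp flip: a_inv_def)
  qed (simp_all add: T.ring_axioms mult mult')
qed

lemma mpoly_ideal_diff:
  assumes K: "ideal K (mpoly_ring V)" and "x \<in> K" "y \<in> K"
  shows "x - y \<in> K"
proof -
  have "- 1 * y \<in> K"
    using ideal.I_l_closed[OF K \<open>y \<in> K\<close>, of "- 1"] by (simp add: mem_mpoly_ring)
  then show ?thesis
    using additive_subgroup.a_closed[OF ideal.axioms(1)[OF K] \<open>x \<in> K\<close>, of "- 1 * y"] by simp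
qed

lemma lin_ext_in_ideal:
  assumes K: "ideal K (mpoly_ring V)" and F: "\<And>m. m \<in> Poly_Mapping.keys p \<Longrightarrow> F m \<in> K"
  shows "lin_ext F p \<in> K"
proof -
  have "(\<Sum>m\<in>A. Poly_Mapping.single 0 (Poly_Mapping.lookup p m) * F m) \<in> K"
    if "finite A" "A \<subseteq> Poly_Mapping.keys p" for A
    using that
  proof (induction A rule: finite_induct)
    case empty
    then show ?case using additive_subgroup.zero_closed[OF ideal.axioms(1)[OF K]] by simp
  next
    case (insert m A)
    have "Poly_Mapping.single 0 (Poly_Mapping.lookup p m) * F m \<in> K"
      using ideal.I_l_closed[OF K F, of m "Poly_Mapping.single 0 (Poly_Mapping.lookup p m)"] insert
      by (simp add: mem_mpoly_ring)
    then show ?case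
      using insert additive_subgroup.a_closed[OF ideal.axioms(1)[OF K]] by simp
  qed
  from this[OF finite_keys order.refl] show ?thesis by (simp add: lin_ext_def)
qed

section \<open>Normal forms modulo polynomials with coprime leading terms\<close>

text \<open>The weight \<open>w\<close> takes the place of a monomial order: the rewriting only has to single out
  one monomial \<open>u r\<close> of \<open>f r = u r + g r\<close> and to terminate. For pairwise coprime leading
  monomials the family \<open>f\<close> is then automatically a Groebner basis, which is what
  confluence of the rewriting expresses.\<close>

locale coprime_leading_terms =
  fixes V :: "'v set" and S :: "'i set"
    and u :: "'i \<Rightarrow> 'v \<Rightarrow>\<^sub>0 nat" and g :: "'i \<Rightarrow> ('v, 'k::comm_ring_1) mpoly"
    and w :: "('v \<Rightarrow>\<^sub>0 nat) \<Rightarrow> nat"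
  assumes u_vars: "r \<in> S \<Longrightarrow> Poly_Mapping.keys (u r) \<subseteq> V"
    and g_carrier: "r \<in> S \<Longrightarrow> g r \<in> carrier (mpoly_ring V)"
    and coprime: "r \<in> S \<Longrightarrow> s \<in> S \<Longrightarrow> r \<noteq> s \<Longrightarrow>
      Poly_Mapping.keys (u r) \<inter> Poly_Mapping.keys (u s) = {}"
    and w_add: "w (a + b) = w a + w b"
    and w_less: "r \<in> S \<Longrightarrow> b \<in> Poly_Mapping.keys (g r) \<Longrightarrow> w b < w (u r)"
begin

definition f :: "'i \<Rightarrow> ('v, 'k) mpoly" where
  "f r = Poly_Mapping.single (u r) 1 + g r"

text \<open>A multiple of several \<open>u r\<close> can be rewritten in several ways; the normal form fixes one
  of them, and \<open>nf_confluent\<close> shows afterwards that the choice is immaterial.\<close>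

definition reducer :: "('v \<Rightarrow>\<^sub>0 nat) \<Rightarrow> 'i" where
  "reducer m = (SOME r. r \<in> S \<and> (\<exists>t. m = u r + t))"

lemma reducer:
  assumes "\<exists>r\<in>S. \<exists>t. m = u r + t"
  shows "reducer m \<in> S" and "m = u (reducer m) + (m - u (reducer m))"
proof -
  have "reducer m \<in> S \<and> (\<exists>t. m = u (reducer m) + t)"
    unfolding reducer_def by (rule someI_ex) (use assms in blast)
  then obtain t where "reducer m \<in> S" "m = u (reducer m) + t" by blast
  then show "reducer m \<in> S" and "m = u (reducer m) + (m - u (reducer m))"
    by (metis, metis add_diff_cancel_left')
qed

function nf :: "('v \<Rightarrow>\<^sub>0 nat) \<Rightarrow> ('v, 'k) mpoly" where
  "nf m = (if \<exists>r\<in>S. \<exists>t. m = u r + t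
     then - (\<Sum>b\<in>Poly_Mapping.keys (g (reducer m)).
       Poly_Mapping.single 0 (Poly_Mapping.lookup (g (reducer m)) b) * nf (m - u (reducer m) + b))
     else Poly_Mapping.single m 1)"
  by auto
termination
proof (relation "measure w")
  fix m b
  assume m: "\<exists>r\<in>S. \<exists>t. m = u r + t" and b: "b \<in> Poly_Mapping.keys (g (reducer m))"
  have "w m = w (u (reducer m)) + w (m - u (reducer m))"
    by (subst reducer(2)[OF m]) (rule w_add)
  then show "(m - u (reducer m) + b, m) \<in> measure w"
    using w_less[OF reducer(1)[OF m] b] by (simp add: w_add)
qed simp

declare nf.simps [simp del]

lemma nf_irreducible: "\<not> (\<exists>r\<in>S. \<exists>t. m = u r + t) \<Longrightarrow> nf m = Poly_Mapping.single m 1"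
  by (subst nf.simps) (simp only: if_False)

lemma nf_reducer:
  assumes "\<exists>r\<in>S. \<exists>t. m = u r + t"
  shows "nf m = - lin_ext (\<lambda>b. nf (m - u (reducer m) + b)) (g (reducer m))"
  by (subst nf.simps) (simp only: assms if_True lin_ext_def)

lemma common_multiple:
  assumes "r \<in> S" "s \<in> S" "r \<noteq> s" "u r + t = u s + t'"
  obtains a where "t = u s + a" "t' = u r + a"
proof -
  have "t = u s + (t - u s)"
  proof (rule poly_mapping_eqI)
    fix v
    have e: "Poly_Mapping.lookup (u r) v + Poly_Mapping.lookup t v
        = Poly_Mapping.lookup (u s) v + Poly_Mapping.lookup t' v"
      using arg_cong[OF assms(4), of "\<lambda>m. Poly_Mapping.lookup m v"] by (simp add: lookup_add)
    have "Poly_Mapping.lookup (u r) v = 0 \<or> Poly_Mapping.lookup (u s) v = 0"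
      using coprime[OF assms(1-3)] by (auto simp: in_keys_iff)
    with e show "Poly_Mapping.lookup t v = Poly_Mapping.lookup (u s + (t - u s)) v"
      by (auto simp: lookup_add lookup_minus)
  qed
  moreover from this have "t' = u r + (t - u s)"
    using assms(4) by (metis add.left_commute add_left_cancel)
  ultimately show ?thesis by (rule that)
qed

text \<open>If the reducer \<open>s\<close> chosen for \<open>u r + t\<close> differs from \<open>r\<close>, coprimality makes the monomial
  a multiple \<open>u r + u s + a\<close> of both leading monomials. Rewriting \<open>u s\<close> leaves terms of smaller
  weight that still contain \<open>u r\<close>, and vice versa. By induction both routes lead to the
  normal form of \<open>a\<close> times \<open>g r * g s\<close>. This is the argument by which Buchberger's
  product criterion holds.\<close>

lemma nf_confluent:
  assumes "r \<in> S"
  shows "nf (u r + t) = - lin_ext (\<lambda>b. nf (t + b)) (g r)"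
  using assms
proof (induction "w (u r + t)" arbitrary: r t rule: less_induct)
  case less
  define m where "m = u r + t"
  have ex: "\<exists>r\<in>S. \<exists>t. m = u r + t" using less.prems by (auto simp: m_def)
  define s where "s = reducer m"
  define t' where "t' = m - u s"
  have s: "s \<in> S" and m_s: "m = u s + t'"
    using reducer[OF ex] by (simp_all add: s_def t'_def)
  have nf_m: "nf m = - lin_ext (\<lambda>b. nf (t' + b)) (g s)"
    unfolding s_def t'_def by (rule nf_reducer[OF ex])
  show ?case
  proof (cases "s = r")
    case True
    then show ?thesis using nf_m m_s by (simp add: m_def)
  next
    case False
    obtain a where a: "t = u s + a" "t' = u r + a"
      using common_multiple[of r s t t'] less.prems s False m_s by (auto simp: m_def)
    have 1: "nf (t' + b) = - lin_ext (\<lambda>c. nf (a + (b + c))) (g r)"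
      if "b \<in> Poly_Mapping.keys (g s)" for b
    proof -
      have "w (u r + (a + b)) < w (u r + t)"
        using w_less[OF s that] by (simp add: a w_add)
      from less.hyps[OF this less.prems] show ?thesis by (simp add: a add.assoc)
    qed
    have 2: "nf (t + b) = - lin_ext (\<lambda>c. nf (a + (b + c))) (g s)"
      if "b \<in> Poly_Mapping.keys (g r)" for b
    proof -
      have "w (u s + (a + b)) < w (u r + t)"
        using w_less[OF less.prems that] by (simp add: a w_add)
      from less.hyps[OF this s] show ?thesis by (simp add: a add.assoc)
    qed
    have "nf m = lin_ext (\<lambda>c. nf (a + c)) (g s * g r)"
      using lin_ext_cong[of "g s", OF 1] unfolding nf_m lin_ext_mult
      by (simp add: lin_ext_uminus_fun)
    moreover have "lin_ext (\<lambda>b. nf (t + b)) (g r) = - lin_ext (\<lambda>c. nf (a + c)) (g r * g s)"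
      using lin_ext_cong[of "g r", OF 2] unfolding lin_ext_mult
      by (simp add: lin_ext_uminus_fun)
    ultimately show ?thesis by (simp add: m_def mult.commute)
  qed
qed

abbreviation NF :: "('v, 'k) mpoly \<Rightarrow> ('v, 'k) mpoly" where
  "NF \<equiv> lin_ext nf"

lemma NF_mult_f:
  assumes "r \<in> S"
  shows "NF (p * f r) = 0"
proof -
  have "NF (Poly_Mapping.single t c * f r) = 0" for t c
    using nf_confluent[OF assms, of t]
    by (simp add: lin_ext_single_mult f_def lin_ext_add add.commute)
  then show ?thesis
    by (induction p rule: mpoly_add_induct) (simp_all add: distrib_right lin_ext_add)
qed

text \<open>Multiplying by a monomial coprime to all \<open>u r\<close> neither creates nor destroys a possible
  rewriting step. The reducers chosen for \<open>m\<close> and \<open>a + m\<close> may still differ, and confluence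
  bridges that.\<close>

lemma nf_mult_coprime:
  assumes "\<And>r. r \<in> S \<Longrightarrow> Poly_Mapping.keys a \<inter> Poly_Mapping.keys (u r) = {}"
  shows "nf (a + m) = Poly_Mapping.single a 1 * nf m"
proof (induction "w m" arbitrary: m rule: less_induct)
  case less
  show ?case
  proof (cases "\<exists>r\<in>S. \<exists>t. m = u r + t")
    case True
    then obtain r t where r: "r \<in> S" and m: "m = u r + t" by blast
    have "nf (a + m) = - lin_ext (\<lambda>b. nf (a + (t + b))) (g r)"
      using nf_confluent[OF r, of "a + t"] by (simp add: m ac_simps)
    also have "lin_ext (\<lambda>b. nf (a + (t + b))) (g r)
        = lin_ext (\<lambda>b. Poly_Mapping.single a 1 * nf (t + b)) (g r)"
      using w_less[OF r] by (intro lin_ext_cong less.hyps) (simp add: m w_add)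
    finally show ?thesis
      using nf_confluent[OF r, of t] by (simp add: m lin_ext_mult_fun)
  next
    case False
    have "\<not> (\<exists>r\<in>S. \<exists>t. a + m = u r + t)"
    proof
      assume "\<exists>r\<in>S. \<exists>t. a + m = u r + t"
      then obtain r t where r: "r \<in> S" and e: "a + m = u r + t" by blast
      have "m = u r + (m - u r)"
      proof (rule poly_mapping_eqI)
        fix v
        have "Poly_Mapping.lookup a v + Poly_Mapping.lookup m v
            = Poly_Mapping.lookup (u r) v + Poly_Mapping.lookup t v"
          using arg_cong[OF e, of "\<lambda>m. Poly_Mapping.lookup m v"] by (simp add: lookup_add)
        moreover have "Poly_Mapping.lookup a v = 0 \<or> Poly_Mapping.lookup (u r) v = 0"
          using assms[OF r] by (auto simp: in_keys_iff)
        ultimately show "Poly_Mapping.lookup m v = Poly_Mapping.lookup (u r + (m - u r)) v"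
          by (auto simp: lookup_add lookup_minus)
      qed
      with r False show False by blast
    qed
    then show ?thesis using False by (simp add: nf_irreducible mult_single)
  qed
qed

lemma NF_mult_coprime:
  assumes a: "a \<in> carrier (mpoly_ring W)"
    and W: "\<And>r. r \<in> S \<Longrightarrow> W \<inter> Poly_Mapping.keys (u r) = {}"
  shows "NF (a * p) = a * NF p"
proof -
  have "NF (a * p) = lin_ext (\<lambda>m. Poly_Mapping.single m 1 * NF p) a"
    unfolding lin_ext_mult
  proof (rule lin_ext_cong)
    fix m assume "m \<in> Poly_Mapping.keys a"
    with a have "Poly_Mapping.keys m \<subseteq> W" by (auto simp: mem_mpoly_ring)
    with W have "nf (m + b) = Poly_Mapping.single m 1 * nf b" for b
      by (intro nf_mult_coprime) blast
    then show "lin_ext (\<lambda>b. nf (m + b)) p = Poly_Mapping.single m 1 * NF p"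
      by (simp add: lin_ext_mult_fun)
  qed
  also have "\<dots> = a * NF p"
    by (induction a rule: mpoly_add_induct)
      (simp_all add: lin_ext_add distrib_right mult_single flip: mult.assoc)
  finally show ?thesis .
qed

lemma f_carrier: "r \<in> S \<Longrightarrow> f r \<in> carrier (mpoly_ring V)"
  unfolding f_def
  by (intro mpoly_ring_add_closed g_carrier) (use u_vars in \<open>auto simp: mem_mpoly_ring\<close>)

text \<open>One rewriting step subtracts a multiple of some \<open>f r\<close>; the rest is induction on the weight.
  Indeterminates outside \<open>V\<close> never enter, since they occur neither in \<open>p\<close> nor in any \<open>g r\<close>.\<close>

lemma diff_NF_in_ideal:
  assumes K: "ideal K (mpoly_ring V)" and f: "\<And>r. r \<in> S \<Longrightarrow> f r \<in> K"
    and p: "p \<in> carrier (mpoly_ring V)"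
  shows "p - NF p \<in> K"
proof -
  have "Poly_Mapping.single m 1 - nf m \<in> K" if "Poly_Mapping.keys m \<subseteq> V" for m
    using that
  proof (induction "w m" arbitrary: m rule: less_induct)
    case less
    show ?case
    proof (cases "\<exists>r\<in>S. \<exists>t. m = u r + t")
      case True
      then obtain r t where r: "r \<in> S" and m: "m = u r + t" by blast
      have t: "Poly_Mapping.keys t \<subseteq> V"
        using less.prems by (auto simp: m in_keys_iff lookup_add)
      have "Poly_Mapping.single t 1 * f r \<in> K"
        using ideal.I_l_closed[OF K f[OF r], of "Poly_Mapping.single t 1"] t
        by (simp add: mem_mpoly_ring)
      moreover have "lin_ext (\<lambda>b. Poly_Mapping.single (t + b) 1 - nf (t + b)) (g r) \<in> K"
      proof (rule lin_ext_in_ideal[OF K])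
        fix b assume b: "b \<in> Poly_Mapping.keys (g r)"
        have "Poly_Mapping.keys b \<subseteq> V" using g_carrier[OF r] b by (auto simp: mem_mpoly_ring)
        with t have "Poly_Mapping.keys (t + b) \<subseteq> V"
          using Poly_Mapping.keys_add[of t b] by blast
        then show "Poly_Mapping.single (t + b) 1 - nf (t + b) \<in> K"
          using w_less[OF r b] by (intro less.hyps) (simp_all add: m w_add)
      qed
      ultimately have "Poly_Mapping.single t 1 * f r
          - lin_ext (\<lambda>b. Poly_Mapping.single (t + b) 1 - nf (t + b)) (g r) \<in> K"
        by (rule mpoly_ideal_diff[OF K])
      also have "lin_ext (\<lambda>b. Poly_Mapping.single (t + b) 1 - nf (t + b)) (g r)
          = Poly_Mapping.single t 1 * g r + nf m"
        using nf_confluent[OF r, of t]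
          lin_ext_single_mult[of "\<lambda>b. Poly_Mapping.single b 1" t 1 "g r"]
        by (simp add: lin_ext_diff_fun lin_ext_monomial m)
      also have "Poly_Mapping.single t 1 * f r - (Poly_Mapping.single t 1 * g r + nf m)
          = Poly_Mapping.single m 1 - nf m"
        by (simp add: f_def m distrib_left mult_single add.commute)
      finally show ?thesis .
    next
      case False
      then show ?thesis
        using additive_subgroup.zero_closed[OF ideal.axioms(1)[OF K]] by (simp add: nf_irreducible)
    qed
  qed
  then have "lin_ext (\<lambda>m. Poly_Mapping.single m 1 - nf m) p \<in> K"
    using p by (intro lin_ext_in_ideal[OF K]) (auto simp: mem_mpoly_ring)
  then show ?thesis by (simp add: lin_ext_diff_fun lin_ext_monomial)
qed

lemma NF_ideal_eq_0:
  assumes "x \<in> Idl\<^bsub>mpoly_ring V\<^esub> (f ` S)"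
  shows "NF x = 0"
proof -
  interpret T: cring "mpoly_ring V :: ('v, 'k) mpoly ring" by (rule cring_mpoly_ring)
  \<comment> \<open>\<open>NF\<close> is not linear over the whole ring, so its zeros are not visibly closed under
    multiplication; quantifying over the multipliers builds this closure in.\<close>
  let ?K = "{x \<in> carrier (mpoly_ring V). \<forall>c \<in> carrier (mpoly_ring V). NF (c * x) = 0}"
  have "ideal ?K (mpoly_ring V)"
    by (rule mpoly_idealI)
      (auto simp: mem_mpoly_ring[of 0] mpoly_ring_add_closed mpoly_ring_mult_closed distrib_left
        lin_ext_add simp flip: mult.assoc)
  moreover have "f ` S \<subseteq> ?K" by (auto simp: f_carrier NF_mult_f)
  ultimately have "x \<in> ?K" using T.genideal_minimal assms by blast
  moreover have "(1 :: ('v, 'k) mpoly) \<in> carrier (mpoly_ring V)" by (simp add: mem_mpoly_ring)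
  ultimately show ?thesis by force
qed

text \<open>For a generator \<open>m\<close> of \<open>J\<close>, linearity gives \<open>c * m - NF (c * m) = (c - NF c) * m\<close>, a
  product of an element of \<open>I\<close> and one of \<open>J\<close>. So \<open>x - NF x\<close> lies in the product ideal for all
  \<open>x\<close> in \<open>J\<close>, and for \<open>x\<close> in \<open>I\<close> this difference is \<open>x\<close> itself.\<close>

theorem ideal_inter_eq_ideal_prod:
  assumes M: "M \<subseteq> carrier (mpoly_ring W)" "W \<subseteq> V"
    and W: "\<And>r. r \<in> S \<Longrightarrow> W \<inter> Poly_Mapping.keys (u r) = {}"
  defines "I \<equiv> Idl\<^bsub>mpoly_ring V\<^esub> (f ` S)" and "J \<equiv> Idl\<^bsub>mpoly_ring V\<^esub> M"
  shows "I \<inter> J = I \<cdot>\<^bsub>mpoly_ring V\<^esub> J"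
proof -
  interpret T: cring "mpoly_ring V :: ('v, 'k) mpoly ring" by (rule cring_mpoly_ring)
  have MV: "M \<subseteq> carrier (mpoly_ring V)" using M by (fastforce simp: mem_mpoly_ring)
  have I: "ideal I (mpoly_ring V)" unfolding I_def
    by (rule T.genideal_ideal) (auto simp: f_carrier)
  have J: "ideal J (mpoly_ring V)" unfolding J_def by (rule T.genideal_ideal[OF MV])
  let ?P = "I \<cdot>\<^bsub>mpoly_ring V\<^esub> J"
  have P: "ideal ?P (mpoly_ring V)" by (rule T.ideal_prod_is_ideal[OF I J])
  let ?K = "{x \<in> carrier (mpoly_ring V). \<forall>c \<in> carrier (mpoly_ring V). c * x - NF (c * x) \<in> ?P}"
  \<comment> \<open>The quantifier over \<open>c\<close> makes this set an ideal, so that it suffices to check the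
    generators of \<open>J\<close>.\<close>
  have K: "ideal ?K (mpoly_ring V)"
  proof (rule mpoly_idealI)
    fix x y assume "x \<in> ?K" "y \<in> ?K"
    moreover from this have "c * (x + y) - NF (c * (x + y)) \<in> ?P"
      if "c \<in> carrier (mpoly_ring V)" for c
      using additive_subgroup.a_closed[OF ideal.axioms(1)[OF P],
          of "c * x - NF (c * x)" "c * y - NF (c * y)"] that
      by (simp add: distrib_left lin_ext_add algebra_simps)
    ultimately show "x + y \<in> ?K" by (simp add: mpoly_ring_add_closed)
  qed (auto simp: mem_mpoly_ring[of 0] mpoly_ring_mult_closed simp flip: mult.assoc
      intro: additive_subgroup.zero_closed[OF ideal.axioms(1)[OF P], simplified])
  have "M \<subseteq> ?K"
  proof
    fix x assume x: "x \<in> M"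
    have "c * x - NF (c * x) \<in> ?P" if c: "c \<in> carrier (mpoly_ring V)" for c
    proof -
      have "c - NF c \<in> I"
        using T.genideal_self[of "f ` S"] f_carrier
        by (intro diff_NF_in_ideal[OF I _ c]) (auto simp: I_def)
      moreover have "x \<in> J" using T.genideal_self[OF MV] x by (auto simp: J_def)
      ultimately have "(c - NF c) * x \<in> ?P"
        using ideal_prod.prod[of "c - NF c" I x J "mpoly_ring V"] by simp
      moreover have "NF (x * c) = x * NF c"
        using M(1) x by (intro NF_mult_coprime[OF _ W]) auto
      ultimately show ?thesis by (simp add: algebra_simps)
    qed
    then show "x \<in> ?K" using x MV by auto
  qed
  then have JK: "J \<subseteq> ?K" using T.genideal_minimal[OF K] by (simp only: J_def)
  have "x \<in> ?P" if "x \<in> I" "x \<in> J" for x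
  proof -
    have "1 * x - NF (1 * x) \<in> ?P"
      using JK that(2) by (auto simp: mem_mpoly_ring dest!: subsetD bspec[of _ _ 1])
    then show ?thesis using NF_ideal_eq_0 that(1) by (simp add: I_def)
  qed
  then show ?thesis using T.ideal_prod_inter[OF I J] by blast
qed

end

section \<open>The ideals of the generic matrices\<close>

lemma minors_in_mpoly_ring:
  assumes "\<And>r c. r < dim_row M \<Longrightarrow> c < dim_col M \<Longrightarrow> M $$ (r, c) \<in> carrier (mpoly_ring W)"
  shows "minors t M \<subseteq> carrier (mpoly_ring W)"
proof
  fix a assume "a \<in> minors t M"
  then obtain R C where RC: "R \<subseteq> {..<dim_row M}" "C \<subseteq> {..<dim_col M}" "card R = t" "card C = t"
    and a: "a = det (submatrix M R C)" unfolding minors_def by auto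
  have R: "{i. i < dim_row M \<and> i \<in> R} = R" and C: "{i. i < dim_col M \<and> i \<in> C} = C"
    using RC by auto
  have N: "submatrix M R C \<in> carrier_mat t t"
    by (rule carrier_matI) (simp_all only: dim_submatrix R C RC)
  have entry: "submatrix M R C $$ (r, c) \<in> carrier (mpoly_ring W)" if "r < t" "c < t" for r c
  proof -
    have "pick R r \<in> R" "pick C c \<in> C" using that RC by (auto intro!: pick_in_set_le)
    then have "M $$ (pick R r, pick C c) \<in> carrier (mpoly_ring W)"
      using RC(1,2) by (intro assms) auto
    then show ?thesis
      using that RC(3,4) by (subst submatrix_index) (simp_all only: R C)
  qed
  have prod: "(\<Prod>i\<in>A. h i) \<in> carrier (mpoly_ring W)"
    if "\<And>i. i \<in> A \<Longrightarrow> h i \<in> carrier (mpoly_ring W)"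
    for A :: "nat set" and h :: "nat \<Rightarrow> ('a, 'b) mpoly"
    using that by (induction A rule: infinite_finite_induct)
      (auto simp: mem_mpoly_ring[of 1] intro!: mpoly_ring_mult_closed)
  have sum: "(\<Sum>i\<in>A. h i) \<in> carrier (mpoly_ring W)"
    if "\<And>i. i \<in> A \<Longrightarrow> h i \<in> carrier (mpoly_ring W)"
    for A :: "(nat \<Rightarrow> nat) set" and h :: "(nat \<Rightarrow> nat) \<Rightarrow> ('a, 'b) mpoly"
    using that by (induction A rule: infinite_finite_induct)
      (auto simp: mem_mpoly_ring[of 0] intro!: mpoly_ring_add_closed)
  have sign: "signof \<pi> \<in> carrier (mpoly_ring W :: ('a, 'b) mpoly ring)" for \<pi> :: "nat \<Rightarrow> nat"
    by (auto simp: sign_def mem_mpoly_ring)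
  show "a \<in> carrier (mpoly_ring W)"
    unfolding a det_def'[OF N]
    by (intro sum mpoly_ring_mult_closed sign prod entry)
      (auto simp: permutes_in_image[of _ "{0..<t}", simplified])
qed

theorem theorem3p7:
  fixes n p q i :: nat
    and T :: "(gvar, 'k::field) mpoly ring"
    and I J :: "(gvar, 'k) mpoly set"
  assumes "n \<ge> 2"
    and "p \<in> {1..n}" and "q \<in> {1..n}" and "i \<in> {1..n}"
    and "p \<noteq> i" and "p \<noteq> q"
    and "T = mpoly_ring (gvars n)"
    and "I = det_ideal T 1 (X_mat n * Y_mat n)"
    and "J = det_ideal T 2 (H_mat n p q i)"
  shows "I \<inter> J = I \<cdot>\<^bsub>T\<^esub> J"
proof -
  define u :: "nat \<Rightarrow> gvar \<Rightarrow>\<^sub>0 nat" where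
    "u r = Poly_Mapping.single (XVar r r) 1 + Poly_Mapping.single (YVar r) 1" for r
  define g :: "nat \<Rightarrow> (gvar, 'k) mpoly" where
    "g r = (\<Sum>s\<in>{1..n} - {r}. xx r s * yy s)" for r
  define w :: "(gvar \<Rightarrow>\<^sub>0 nat) \<Rightarrow> nat" where
    "w m = (\<Sum>r = 1..n. Poly_Mapping.lookup m (XVar r r))" for m
  have keys_u: "Poly_Mapping.keys (u r) = {XVar r r, YVar r}" for r
    by (auto simp: u_def in_keys_iff lookup_add lookup_single when_def split: if_splits)
  have xy: "xx r s * (yy s :: (gvar, 'k) mpoly) = Poly_Mapping.single
      (Poly_Mapping.single (XVar r s) 1 + Poly_Mapping.single (YVar s) 1) 1" for r s
    by (simp add: indet_def mult_single)
  have keys_g: "\<exists>s \<in> {1..n} - {r}.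
      b = Poly_Mapping.single (XVar r s) 1 + Poly_Mapping.single (YVar s) 1"
    if b: "b \<in> Poly_Mapping.keys (g r)" for b r
  proof -
    obtain s where "s \<in> {1..n} - {r}" "b \<in> Poly_Mapping.keys (xx r s * (yy s :: (gvar, 'k) mpoly))"
      using b Poly_Mapping.keys_sum[of "\<lambda>s. xx r s * (yy s :: (gvar, 'k) mpoly)" "{1..n} - {r}"]
      unfolding g_def by blast
    then show ?thesis unfolding xy by (intro bexI[of _ s]) simp_all
  qed
  interpret coprime_leading_terms "gvars n" "{1..n}" u g w
  proof
    fix r assume r: "r \<in> {1..n}"
    then show "Poly_Mapping.keys (u r) \<subseteq> gvars n" by (auto simp: keys_u gvars_def)
    show "g r \<in> carrier (mpoly_ring (gvars n))"
      unfolding mem_mpoly_ring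
    proof
      fix b assume "b \<in> Poly_Mapping.keys (g r)"
      then obtain s where s: "s \<in> {1..n}"
        and b: "b = Poly_Mapping.single (XVar r s) 1 + Poly_Mapping.single (YVar s) 1"
        using keys_g by blast
      show "Poly_Mapping.keys b \<subseteq> gvars n"
        unfolding b using r s by (intro order.trans[OF Poly_Mapping.keys_add]) (auto simp: gvars_def)
    qed
    fix b assume "b \<in> Poly_Mapping.keys (g r)"
    then obtain s where s: "s \<noteq> r"
      and b: "b = Poly_Mapping.single (XVar r s) 1 + Poly_Mapping.single (YVar s) 1"
      using keys_g by blast
    have "w b = 0" using s by (auto simp: w_def b lookup_add lookup_single when_def)
    moreover have "w (u r) = 1"
      using r by (simp add: w_def u_def lookup_add lookup_single when_def)
    ultimately show "w b < w (u r)" by simp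
  qed (auto simp: keys_u w_def lookup_add sum.distrib)
  \<comment> \<open>The off-diagonal indeterminates; they contain the entries of \<open>H\<close>, the last of them
    because \<open>p \<noteq> q\<close>.\<close>
  define W where "W = {XVar r s | r s. r \<in> {1..n} \<and> s \<in> {1..n} \<and> r \<noteq> s}"
  have f_eq: "f r = (\<Sum>s = 1..n. xx r s * yy s)" if "r \<in> {1..n}" for r
    unfolding f_def g_def u_def xy[symmetric] using that by (simp add: sum.remove)
  have "{\<Sum>s = 1..n. xx r s * (yy s :: (gvar, 'k) mpoly) | r. r \<in> {1..n}} = f ` {1..n}"
    using f_eq by (auto simp: image_iff)
  then have I: "I = Idl\<^bsub>mpoly_ring (gvars n)\<^esub> (f ` {1..n})"
    using assms(7,8) by (simp only: det_ideal_XY)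
  have J: "J = Idl\<^bsub>mpoly_ring (gvars n)\<^esub> (minors 2 (H_mat n p q i))"
    using assms(7,9) by (simp only: det_ideal_def)
  have "set (H_entries n p q i) \<subseteq> carrier (mpoly_ring W :: (gvar, 'k) mpoly ring)"
    using assms(2-6) by (auto simp: H_entries_def W_def)
  moreover have "length (H_entries n p q i :: (gvar, 'k) mpoly list) = n"
    using assms(4) by (rule length_H_entries)
  ultimately have "minors 2 (H_mat n p q i) \<subseteq> carrier (mpoly_ring W :: (gvar, 'k) mpoly ring)"
    using assms(1) by (intro minors_in_mpoly_ring) (auto simp: H_mat_def)
  then show ?thesis
    unfolding I J assms(7)
    by (rule ideal_inter_eq_ideal_prod) (auto simp: W_def gvars_def keys_u)
qed

end
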